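(* The Klein configuration $Z_{60}$ cannot be realized over the reals. That is, there is no set of $60$ points in $\mathbb{P}^3(\mathbb{R})$ with the same collinearities and coplanarities as those in $Z_{60}$: there is no injective map $\varphi: Z_{60}\to\mathbb{P}^3(\mathbb{R})$ such that for every subset $S\subseteq Z_{60}$, the points of $S$ are collinear if and only if the points of $\varphi(S)$ are collinear, and the points of $S$ are coplanar if and only if the points of $\varphi(S)$ are coplanar.
   Context: The Klein configuration $Z_{60}\subset\mathbb{P}^3=\mathbb{P}^3_{\mathbb{C}}$ (homogeneous coordinates $[x:y:z:w]$) is the following set of $60$ points: the $4$ coordinate points $[1:0:0:0],[0:1:0:0],[0:0:1:0],[0:0:0:1]$; the $24$ points having exactly two nonzero coordinates, the first nonzero coordinate being $1$ and the other one lying in $\{1,i,-1,-i\}$; and the $32$ points $[1:\pm1:\pm1:\pm1]$, $[1:\pm1:\pm i:\pm i]$, $[1:\pm i:\pm1:\pm i]$, $[1:\pm i:\pm i:\pm1]$ (all signs chosen independently). Collinearity and coplanarity of points of $Z_{60}$ are understood in $\mathbb{P}^3(\mathbb{C})$, those of their images in $\mathbb{P}^3(\mathbb{R})$. A set of points is collinear (coplanar) if it is contained in some line (plane). *)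

theory Defs
  imports "HOL-Analysis.Analysis"
begin

definition proj3 :: "('a::field ^ 4) set set" where
  "proj3 = {p. vec.subspace p \<and> vec.dim p = 1}"

text \<open>Projective lines and planes are the subspaces of vector dimension 2 and 3 respectively;
  a point lies on one of them iff it is contained in it as a subspace.\<close>

definition proj_collinear :: "('a::field ^ 4) set set \<Rightarrow> bool" where
  "proj_collinear S \<longleftrightarrow> (\<exists>L. vec.subspace L \<and> vec.dim L = 2 \<and> (\<forall>p\<in>S. p \<subseteq> L))"

definition proj_coplanar :: "('a::field ^ 4) set set \<Rightarrow> bool" where
  "proj_coplanar S \<longleftrightarrow> (\<exists>H. vec.subspace H \<and> vec.dim H = 3 \<and> (\<forall>p\<in>S. p \<subseteq> H))"

text \<open>The point with homogeneous coordinates \<open>[x : y : z : w]\<close> (not all zero).\<close>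

definition hpt :: "'a::field \<Rightarrow> 'a \<Rightarrow> 'a \<Rightarrow> 'a \<Rightarrow> ('a ^ 4) set" where
  "hpt x y z w = vec.span {vector [x, y, z, w]}"

definition klein_config :: "(complex ^ 4) set set" where
  "klein_config =
     {hpt 1 0 0 0, hpt 0 1 0 0, hpt 0 0 1 0, hpt 0 0 0 1}
   \<union> (\<Union>u\<in>{1, \<i>, -1, -\<i>}.
        {hpt 1 u 0 0, hpt 1 0 u 0, hpt 1 0 0 u, hpt 0 1 u 0, hpt 0 1 0 u, hpt 0 0 1 u})
   \<union> {hpt 1 a b c | a b c. a \<in> {1, -1} \<and> b \<in> {1, -1} \<and> c \<in> {1, -1}}
   \<union> {hpt 1 a b c | a b c. a \<in> {1, -1} \<and> b \<in> {\<i>, -\<i>} \<and> c \<in> {\<i>, -\<i>}}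
   \<union> {hpt 1 a b c | a b c. a \<in> {\<i>, -\<i>} \<and> b \<in> {1, -1} \<and> c \<in> {\<i>, -\<i>}}
   \<union> {hpt 1 a b c | a b c. a \<in> {\<i>, -\<i>} \<and> b \<in> {\<i>, -\<i>} \<and> c \<in> {1, -1}}"

lemma vector4_nth [simp]:
  "(vector [x, y, z, w] :: 'a::zero ^ 4) $ 1 = x"
  "(vector [x, y, z, w] :: 'a::zero ^ 4) $ 2 = y"
  "(vector [x, y, z, w] :: 'a::zero ^ 4) $ 3 = z"
  "(vector [x, y, z, w] :: 'a::zero ^ 4) $ 4 = w"
  unfolding vector_def by simp_all

lemma hpt_in_proj3:
  assumes "x \<noteq> 0 \<or> y \<noteq> 0 \<or> z \<noteq> 0 \<or> w \<noteq> 0"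
  shows "hpt x y z w \<in> proj3"
proof -
  have "(vector [x, y, z, w] :: 'a ^ 4) \<noteq> 0"
    using assms by (auto simp: vec_eq_iff forall_4)
  then show ?thesis
    by (simp add: hpt_def proj3_def vec.subspace_span)
qed

lemma klein_config_subset: "klein_config \<subseteq> proj3"
  by (auto simp: klein_config_def intro!: hpt_in_proj3)

lemma hpt_eqD:
  assumes "hpt x y z w = hpt x' y' z' w'"
  shows "\<exists>k. x = k * x' \<and> y = k * y' \<and> z = k * z' \<and> w = k * w'"
proof -
  have "vector [x, y, z, w] \<in> hpt x' y' z' w'"
    unfolding assms[symmetric] by (simp add: hpt_def vec.span_base)
  then obtain k where "vector [x, y, z, w] = k *s (vector [x', y', z', w'] :: 'a ^ 4)"
    by (auto simp: hpt_def vec.span_singleton)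
  then show ?thesis
    by (auto simp: vec_eq_iff forall_4)
qed

lemma card_klein_config: "card klein_config = 60"
proof -
  let ?h = "\<lambda>(x, y, z, w). hpt x y z w :: (complex ^ 4) set"
  define A :: "(complex \<times> complex \<times> complex \<times> complex) set" where "A = {(1,0,0,0), (0,1,0,0), (0,0,1,0), (0,0,0,1)}"
  define B :: "(complex \<times> complex \<times> complex \<times> complex) set" where "B = (\<Union>u\<in>{1, \<i>, -1, -\<i>}.
    {(1,u,0,0), (1,0,u,0), (1,0,0,u), (0,1,u,0), (0,1,0,u), (0,0,1,u)})"
  define C :: "complex \<Rightarrow> complex \<Rightarrow> complex \<Rightarrow> (complex \<times> complex \<times> complex \<times> complex) set" where "C a b c = Pair 1 ` ({a,-a} \<times> {b,-b} \<times> {c,-c})" for a b c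
  define N :: "(complex \<times> complex \<times> complex \<times> complex) set" where
    "N = {(x, y, z, w). x = 1 \<or> x = 0 \<and> (y = 1 \<or> y = 0 \<and> (z = 1 \<or> z = 0 \<and> w = 1))}"
  define Z where "Z = A \<union> (B \<union> (C 1 1 1 \<union> (C 1 \<i> \<i> \<union> (C \<i> 1 \<i> \<union> C \<i> \<i> 1))))"
  have A: "?h ` A = {hpt 1 0 0 0, hpt 0 1 0 0, hpt 0 0 1 0, hpt 0 0 0 1}"
    by (simp add: A_def)
  have B: "?h ` B = (\<Union>u\<in>{1, \<i>, -1, -\<i>}.
      {hpt 1 u 0 0, hpt 1 0 u 0, hpt 1 0 0 u, hpt 0 1 u 0, hpt 0 1 0 u, hpt 0 0 1 u})"
    unfolding B_def image_UN by simp
  have C: "?h ` C p q r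
    = {hpt 1 a b c | a b c. a \<in> {p,-p} \<and> b \<in> {q,-q} \<and> c \<in> {r,-r}}" for p q r
  proof -
    have "?h ` C p q r = (\<lambda>(a, b, c). hpt 1 a b c) ` ({p,-p} \<times> {q,-q} \<times> {r,-r})"
      by (simp only: C_def image_image prod.case)
    also have "\<dots> = {hpt 1 a b c | a b c. a \<in> {p,-p} \<and> b \<in> {q,-q} \<and> c \<in> {r,-r}}"
      by (simp only: image_def Bex_def split_paired_Ex mem_Times_iff fst_conv snd_conv prod.case)
        blast
    finally show ?thesis .
  qed
  have img: "klein_config = ?h ` Z"
    unfolding klein_config_def Z_def image_Un A B C by (simp only: Un_assoc)
  have inj: "inj_on ?h N"
    by (rule inj_onI) (auto simp: N_def dest!: hpt_eqD)
  have ZN: "Z \<subseteq> N"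
    by (auto simp: N_def Z_def A_def B_def C_def)
  have cZ: "card Z = 60"
  proof -
    have 1: "card A = 4" by (simp add: A_def)
    have 2: "card B = 24" by (simp add: B_def complex_eq_iff)
    have 3: "card (C p q r) = 8" if "p \<noteq> 0" "q \<noteq> 0" "r \<noteq> 0" for p q r
      using that by (simp add: C_def card_image inj_on_def card_cartesian_product)
    have fin: "finite A" "finite B" "finite (C p q r)" for p q r
      by (simp_all add: A_def B_def C_def)
    have nz: "x \<noteq> 0 \<and> y \<noteq> 0 \<and> z \<noteq> 0 \<and> w \<noteq> 0"
      if "(x, y, z, w) \<in> C p q r" "p \<noteq> 0" "q \<noteq> 0" "r \<noteq> 0" for x y z w p q r
      using that by (auto simp: C_def)
    have disj: "A \<inter> B = {}" "A \<inter> C p q r = {}" "B \<inter> C p q r = {}"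
      if "p \<noteq> 0" "q \<noteq> 0" "r \<noteq> 0" for p q r
      using that by (auto simp: A_def B_def dest: nz)
    have CC: "C p q r \<inter> C p' q' r' = {}"
      if "p\<^sup>2 \<noteq> p'\<^sup>2 \<or> q\<^sup>2 \<noteq> q'\<^sup>2 \<or> r\<^sup>2 \<noteq> r'\<^sup>2" for p q r p' q' r'
      using that by (auto simp: C_def)
    show ?thesis
      unfolding Z_def
      by (simp add: card_Un_disjoint fin Int_Un_distrib disj[of 1 1 1] disj CC 1 2 3)
  qed
  show ?thesis
    unfolding img card_image[OF inj_on_subset[OF inj ZN]] by (rule cZ)
qed

end

theory Submission
  imports Defs
begin

text \<open>
  Only the points of \<open>Z\<^sub>6\<^sub>0\<close> on the sides of the triangle \<open>e\<^sub>1 e\<^sub>2 e\<^sub>3\<close> are needed. For fourth roots of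
  unity \<open>u\<close>, \<open>v\<close> the points \<open>[1:u:0:0]\<close>, \<open>[0:1:v:0]\<close>, \<open>[1:0:-uv:0]\<close> are collinear.
  If \<open>a\<close>, \<open>b\<close>, \<open>c\<close> span the images of the vertices, the images of the other points
  are spanned by \<open>a + f u b\<close>, \<open>b + g v c\<close>, \<open>a + h w c\<close> with nonzero real coefficients,
  and collinearity forces \<open>h (-uv) = - f u g v\<close>. So \<open>f u g v\<close> depends only on \<open>uv\<close>, and
  \<open>u \<mapsto> f u / f 1\<close> is an injective homomorphism from a cyclic group of order 4 to the
  multiplicative group of the reals, which has no element of order 4.
\<close>

section \<open>Projective points as spans of single vectors, and the lines through them\<close>

lemma span_singleton_scale:
  fixes x :: "'a::field ^ 4"
  assumes "k \<noteq> 0"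
  shows "vec.span {k *s x} = vec.span {x}"
proof
  show "vec.span {k *s x} \<subseteq> vec.span {x}"
    by (rule vec.span_minimal) (auto intro: vec.span_scale vec.span_base)
  have "x = inverse k *s (k *s x)"
    using assms by simp
  then have "x \<in> vec.span {k *s x}"
    by (metis vec.span_scale vec.span_base singletonI)
  then show "vec.span {x} \<subseteq> vec.span {k *s x}"
    by (intro vec.span_minimal) auto
qed

lemma independent_pair:
  fixes x y :: "'a::field ^ 4"
  assumes "x \<noteq> 0" "y \<noteq> 0" "vec.span {x} \<noteq> vec.span {y}"
  shows "x \<noteq> y" "vec.independent {x, y}"
proof -
  show "x \<noteq> y"
    using assms(3) by auto
  have "x \<notin> vec.span {y}"
  proof
    assume "x \<in> vec.span {y}"
    then obtain k where "x = k *s y"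
      by (auto simp: vec.span_singleton)
    with assms span_singleton_scale[of k y] show False
      by (cases "k = 0") auto
  qed
  then show "vec.independent {x, y}"
    using \<open>x \<noteq> y\<close> assms(2) by (simp add: vec.independent_insert)
qed

lemma span_pair:
  "z \<in> vec.span {x, y :: 'a::field ^ 4} \<longleftrightarrow> (\<exists>k l. z = k *s x + l *s y)"
  by (auto simp: vec.span_insert vec.span_singleton algebra_simps)

text \<open>Two distinct points determine their line: any two-dimensional \<open>L\<close>
  containing \<open>x\<close> and \<open>y\<close> equals \<open>vec.span {x, y}\<close> by
  dimension, so collinearity becomes a linear equation for \<open>z\<close>.\<close>

lemma proj_collinear_span_iff:
  fixes x y z :: "'a::field ^ 4"
  assumes "x \<noteq> 0" "y \<noteq> 0" "vec.span {x} \<noteq> vec.span {y}"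
  shows "proj_collinear {vec.span {x}, vec.span {y}, vec.span {z}}
    \<longleftrightarrow> (\<exists>k l. z = k *s x + l *s y)"
proof -
  have dim: "vec.dim (vec.span {x, y}) = 2"
    using independent_pair[OF assms] vec.dim_span_eq_card_independent[of "{x, y}"] by simp
  have sub: "vec.span {v} \<subseteq> L \<longleftrightarrow> v \<in> L" if "vec.subspace L" for v and L :: "('a ^ 4) set"
  proof
    assume "vec.span {v} \<subseteq> L"
    then show "v \<in> L"
      using vec.span_base[of v "{v}"] by blast
  next
    assume "v \<in> L"
    then show "vec.span {v} \<subseteq> L"
      using that by (intro vec.span_minimal) auto
  qed
  have "proj_collinear {vec.span {x}, vec.span {y}, vec.span {z}} \<longleftrightarrow> z \<in> vec.span {x, y}"
  proof
    assume "proj_collinear {vec.span {x}, vec.span {y}, vec.span {z}}"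
    then obtain L where L: "vec.subspace L" "vec.dim L = 2" "x \<in> L" "y \<in> L" "z \<in> L"
      unfolding proj_collinear_def by (auto simp: sub)
    have "vec.span {x, y} = L"
    proof (rule vec.subspace_dim_equal)
      show "vec.span {x, y} \<subseteq> L"
        using L by (intro vec.span_minimal) auto
    qed (use L dim in simp_all)
    with L show "z \<in> vec.span {x, y}"
      by simp
  next
    assume "z \<in> vec.span {x, y}"
    then have "\<forall>p\<in>{vec.span {x}, vec.span {y}, vec.span {z}}. p \<subseteq> vec.span {x, y}"
      by (simp add: sub vec.span_base)
    with dim show "proj_collinear {vec.span {x}, vec.span {y}, vec.span {z}}"
      unfolding proj_collinear_def using vec.subspace_span by blast
  qed
  then show ?thesis
    by (simp add: span_pair)
qed

lemma proj3_obtain_span: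
  assumes "p \<in> proj3"
  obtains x where "x \<noteq> 0" "p = vec.span {x}"
proof -
  from assms have p: "vec.subspace p" "vec.dim p = 1"
    by (auto simp: proj3_def)
  obtain B where B: "B \<subseteq> p" "vec.independent B" "p \<subseteq> vec.span B" "card B = vec.dim p"
    by (rule vec.basis_exists)
  then obtain x where "B = {x}"
    using p by (auto simp: card_1_singleton_iff)
  moreover have "vec.span B = p"
    using B p by (simp add: subset_antisym vec.span_minimal)
  moreover have "x \<noteq> 0"
    using B \<open>B = {x}\<close> by auto
  ultimately show thesis
    using that by auto
qed

section \<open>Points on the sides of a triangle\<close>

text \<open>Scaling the coefficient of \<open>a\<close> to 1 leaves a single parameter
  \<open>t\<close>, an affine coordinate on the line.\<close>

lemma third_point_on_line:
  fixes a b :: "'a::field ^ 4"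
  assumes "a \<noteq> 0" "b \<noteq> 0" "vec.span {a} \<noteq> vec.span {b}" "r \<in> proj3"
    and "r \<noteq> vec.span {a}" "r \<noteq> vec.span {b}"
    and "proj_collinear {vec.span {a}, vec.span {b}, r}"
  obtains t where "t \<noteq> 0" "r = vec.span {a + t *s b}"
proof -
  obtain d where d: "d \<noteq> 0" "r = vec.span {d}"
    using assms(4) by (rule proj3_obtain_span)
  obtain k l where kl: "d = k *s a + l *s b"
    using assms(7) d by (auto simp: proj_collinear_span_iff[OF assms(1-3)])
  \<comment> \<open>A vanishing coefficient would make \<open>r\<close> one of the two given
    points.\<close>
  have "k \<noteq> 0" "l \<noteq> 0"
    using kl d assms(5,6) span_singleton_scale[of k a] span_singleton_scale[of l b] by auto
  have "d = k *s (a + (l / k) *s b)"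
    using kl \<open>k \<noteq> 0\<close> by (simp add: vec.scale_right_distrib)
  then have "r = vec.span {a + (l / k) *s b}"
    using d span_singleton_scale[OF \<open>k \<noteq> 0\<close>] by metis
  then show thesis
    using that[of "l / k"] \<open>k \<noteq> 0\<close> \<open>l \<noteq> 0\<close> by simp
qed

text \<open>Menelaus' theorem.\<close>

lemma collinear_on_triangle_sides:
  fixes a b c :: "'a::field ^ 4"
  assumes "a \<noteq> 0" "b \<noteq> 0" "vec.span {a} \<noteq> vec.span {b}"
    and c: "\<not> proj_collinear {vec.span {a}, vec.span {b}, vec.span {c}}"
    and col: "proj_collinear {vec.span {a + s *s b}, vec.span {b + t *s c}, vec.span {a + r *s c}}"
    and "t \<noteq> 0"
  shows "r = - s * t"
proof -
  have nc: "c \<noteq> k *s a + l *s b" for k l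
    using c by (auto simp: proj_collinear_span_iff[OF assms(1-3)])
  \<comment> \<open>Linear independence of \<open>a\<close>, \<open>b\<close>, \<open>c\<close>:
    \<open>m\<close> vanishes because \<open>c\<close> is off the line, then \<open>l\<close>
    because the other two points differ, then \<open>k\<close>.\<close>
  have ind: "k = 0 \<and> l = 0 \<and> m = 0" if "k *s a + l *s b + m *s c = 0" for k l m
  proof -
    have "m = 0"
    proof (rule ccontr)
      assume "m \<noteq> 0"
      have "m *s c = - (k *s a) - l *s b"
        using that by (simp add: eq_neg_iff_add_eq_0 algebra_simps)
      then have "inverse m *s (m *s c) = (- (k / m)) *s a + (- (l / m)) *s b"
        by (simp add: vec_eq_iff field_simps)
      with \<open>m \<noteq> 0\<close> nc[of "- (k / m)" "- (l / m)"] show False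
        by simp
    qed
    moreover have "l = 0"
    proof (rule ccontr)
      assume "l \<noteq> 0"
      have "l *s b = (- k) *s a"
        using that \<open>m = 0\<close> by (simp add: eq_neg_iff_add_eq_0 algebra_simps)
      with \<open>l \<noteq> 0\<close> assms(2,3) span_singleton_scale[of l b] span_singleton_scale[of "- k" a]
      show False
        by (cases "k = 0") auto
    qed
    ultimately show ?thesis
      using that \<open>a \<noteq> 0\<close> by simp
  qed
  have nz: "a + s *s b \<noteq> 0" "b + t *s c \<noteq> 0"
    using ind[of 1 s 0] ind[of 0 1 t] by auto
  have "vec.span {a + s *s b} \<noteq> vec.span {b + t *s c}"
  proof
    assume "vec.span {a + s *s b} = vec.span {b + t *s c}"
    then have "a + s *s b \<in> vec.span {b + t *s c}"
      by (metis vec.span_base singletonI)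
    then obtain k where "a + s *s b = k *s (b + t *s c)"
      by (auto simp: vec.span_singleton)
    then have "1 *s a + (s - k) *s b + (- k * t) *s c = 0"
      by (simp add: vec_eq_iff algebra_simps)
    from ind[OF this] show False
      by simp
  qed
  with nz col obtain k l where "a + r *s c = k *s (a + s *s b) + l *s (b + t *s c)"
    by (auto simp: proj_collinear_span_iff)
  \<comment> \<open>Comparing coefficients gives \<open>k = 1\<close>, \<open>l = - s\<close> and
    \<open>r = l * t\<close>.\<close>
  then have "(1 - k) *s a + (- k * s - l) *s b + (r - l * t) *s c = 0"
    by (simp add: vec_eq_iff algebra_simps)
  from ind[OF this] show ?thesis
    by (auto simp: algebra_simps)
qed

text \<open>Multiplying the argument by \<open>\<i>\<close> multiplies \<open>f\<close> and
  \<open>g\<close> by the same ratio \<open>r\<close>. Four such steps return to the start, so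
  \<open>r ^ 4 = 1\<close>, and a real \<open>r\<close> then has square 1.\<close>

lemma no_real_character_of_order_4:
  fixes f g h :: "complex \<Rightarrow> real"
  assumes U: "U = {1, \<i>, -1, -\<i>}"
    and nz: "\<And>u. u \<in> U \<Longrightarrow> f u \<noteq> 0" "\<And>u. u \<in> U \<Longrightarrow> g u \<noteq> 0"
    and fgh: "\<And>u v. u \<in> U \<Longrightarrow> v \<in> U \<Longrightarrow> h (- (u * v)) = - f u * g v"
  shows "f (-1) = f 1"
proof -
  \<comment> \<open>Both products are minus the value of \<open>h\<close> at the same point, which
    eliminates \<open>h\<close>.\<close>
  have fg: "f u * g v = f u' * g v'"
    if "u \<in> U" "v \<in> U" "u' \<in> U" "v' \<in> U" "u * v = u' * v'" for u v u' v'
    using fgh[of u v] fgh[of u' v'] that by simp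
  define r where "r = f \<i> / f 1"
  have n: "f 1 \<noteq> 0" "g 1 \<noteq> 0"
    using nz U by auto
  have fi: "f \<i> = r * f 1"
    using n by (simp add: r_def)
  have "f \<i> * g 1 = f 1 * g \<i>"
    by (rule fg) (auto simp: U)
  then have gi: "g \<i> = r * g 1"
    using n by (simp add: fi)
  have "f (-1) * g 1 = f \<i> * g \<i>"
    by (rule fg) (auto simp: U)
  then have fm: "f (-1) = r ^ 2 * f 1"
    using n by (simp add: fi gi power2_eq_square)
  have "f (-\<i>) * g 1 = f (-1) * g \<i>"
    by (rule fg) (auto simp: U)
  then have fmi: "f (-\<i>) = r ^ 3 * f 1"
    using n by (simp add: fm gi power2_eq_square power3_eq_cube)
  have "f 1 * g 1 = f (-\<i>) * g \<i>"
    by (rule fg) (auto simp: U)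
  then have "r ^ 4 = 1"
    using n by (simp add: fmi gi power3_eq_cube power4_eq_xxxx)
  \<comment> \<open>The only place where the reals matter: \<open>r ^ 2\<close> is 1 or -1, and a
    real square is not -1. Over the complex numbers \<open>r = \<i>\<close> would be
    possible.\<close>
  then have "r ^ 2 = 1"
    using power2_eq_1_iff[of "r ^ 2"] zero_le_power2[of r] by (simp flip: power_mult)
  then show ?thesis
    by (simp add: fm)
qed

section \<open>The Klein points in coordinates\<close>

lemma proj_collinear_hpt_iff:
  fixes x y z w :: "'a::field"
  assumes "hpt x y z w \<noteq> hpt x' y' z' w'" "x \<noteq> 0 \<or> y \<noteq> 0 \<or> z \<noteq> 0 \<or> w \<noteq> 0"
    "x' \<noteq> 0 \<or> y' \<noteq> 0 \<or> z' \<noteq> 0 \<or> w' \<noteq> 0"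
  shows "proj_collinear {hpt x y z w, hpt x' y' z' w', hpt x'' y'' z'' w''} \<longleftrightarrow>
    (\<exists>k l. x'' = k * x + l * x' \<and> y'' = k * y + l * y' \<and> z'' = k * z + l * z' \<and> w'' = k * w + l * w')"
proof -
  have "vector [x, y, z, w] \<noteq> (0 :: 'a ^ 4)" "vector [x', y', z', w'] \<noteq> (0 :: 'a ^ 4)"
    using assms(2,3) by (auto simp: vec_eq_iff forall_4)
  from proj_collinear_span_iff[OF this] show ?thesis
    using assms(1) unfolding hpt_def by (simp add: vec_eq_iff forall_4)
qed

lemma edge_points_in_klein_config:
  assumes "u \<in> {1, \<i>, -1, -\<i>}"
  shows "hpt 1 u 0 0 \<in> klein_config" "hpt 0 1 u 0 \<in> klein_config" "hpt 1 0 u 0 \<in> klein_config"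
  unfolding klein_config_def
  \<comment> \<open>Four uses of \<open>UnI1\<close> discard the families with all coordinates
    nonzero; \<open>UnI2\<close> then discards the coordinate points.\<close>
  by (rule UnI1, rule UnI1, rule UnI1, rule UnI1, rule UnI2, rule UN_I, rule assms,
      simp)+

theorem proposition6p3:
  shows "\<not> (\<exists>\<phi> :: (complex ^ 4) set \<Rightarrow> (real ^ 4) set.
      inj_on \<phi> klein_config \<and> \<phi> ` klein_config \<subseteq> proj3 \<and>
      (\<forall>S \<subseteq> klein_config.
        (proj_collinear S \<longleftrightarrow> proj_collinear (\<phi> ` S)) \<and>
        (proj_coplanar S \<longleftrightarrow> proj_coplanar (\<phi> ` S))))"
proof (rule notI, elim exE conjE)
  fix \<phi> :: "(complex ^ 4) set \<Rightarrow> (real ^ 4) set"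
  assume inj: "inj_on \<phi> klein_config" and img: "\<phi> ` klein_config \<subseteq> proj3"
    and \<phi>: "\<forall>S \<subseteq> klein_config.
        (proj_collinear S \<longleftrightarrow> proj_collinear (\<phi> ` S)) \<and>
        (proj_coplanar S \<longleftrightarrow> proj_coplanar (\<phi> ` S))"
  have col: "proj_collinear {\<phi> p, \<phi> q, \<phi> r} \<longleftrightarrow> proj_collinear {p, q, r}"
    if "p \<in> klein_config" "q \<in> klein_config" "r \<in> klein_config" for p q r
    using \<phi>[rule_format, of "{p, q, r}"] that by simp
  define U :: "complex set" where "U = {1, \<i>, -1, -\<i>}"
  have U: "u \<noteq> 0" if "u \<in> U" for u
    using that by (auto simp: U_def)
  have U_mult: "- (u * v) \<in> U" if "u \<in> U" "v \<in> U" for u v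
    using that by (auto simp: U_def)
  let ?e1 = "hpt 1 0 0 0 :: (complex ^ 4) set"
  let ?e2 = "hpt 0 1 0 0 :: (complex ^ 4) set"
  let ?e3 = "hpt 0 0 1 0 :: (complex ^ 4) set"
  have e: "?e1 \<in> klein_config" "?e2 \<in> klein_config" "?e3 \<in> klein_config"
    by (simp_all add: klein_config_def)
  have e_ne: "?e1 \<noteq> ?e2" "?e2 \<noteq> ?e3" "?e1 \<noteq> ?e3"
    by (auto dest!: hpt_eqD)
  note edge = edge_points_in_klein_config[folded U_def]
  obtain a b c where abc: "a \<noteq> 0" "b \<noteq> 0" "c \<noteq> 0"
    and span: "\<phi> ?e1 = vec.span {a}" "\<phi> ?e2 = vec.span {b}" "\<phi> ?e3 = vec.span {c}"
  proof -
    have "\<phi> ?e1 \<in> proj3" "\<phi> ?e2 \<in> proj3" "\<phi> ?e3 \<in> proj3"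
      using e img by blast+
    then show thesis
      by (elim proj3_obtain_span) (rule that)
  qed
  \<comment> \<open>Injectivity keeps the image of \<open>r\<close> away from the images of
    \<open>p\<close> and \<open>q\<close>, so both coefficients survive.\<close>
  have side: "\<exists>t. t \<noteq> 0 \<and> \<phi> r = vec.span {x + t *s y}"
    if xy: "\<phi> p = vec.span {x}" "\<phi> q = vec.span {y}" "x \<noteq> 0" "y \<noteq> 0"
      and pqr: "p \<in> klein_config" "q \<in> klein_config" "r \<in> klein_config"
      and ne: "p \<noteq> q" "r \<noteq> p" "r \<noteq> q" and "proj_collinear {p, q, r}"
    for p q r x y
  proof (rule third_point_on_line[OF xy(3,4)])
    show "vec.span {x} \<noteq> vec.span {y}" "\<phi> r \<noteq> vec.span {x}" "\<phi> r \<noteq> vec.span {y}"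
      using inj_onD[OF inj] pqr ne unfolding xy(1,2)[symmetric] by blast+
    show "\<phi> r \<in> proj3"
      using img pqr by blast
    show "proj_collinear {vec.span {x}, vec.span {y}, \<phi> r}"
      using col[OF pqr] that unfolding xy(1,2)[symmetric] by simp
  qed blast
  have "\<exists>t. t \<noteq> 0 \<and> \<phi> (hpt 1 u 0 0) = vec.span {a + t *s b}" if u: "u \<in> U" for u
  proof (rule side[OF span(1,2) abc(1,2) e(1,2) edge(1)[OF u] e_ne(1)])
    show "hpt 1 u 0 0 \<noteq> ?e1" "hpt 1 u 0 0 \<noteq> ?e2"
      using U[OF u] by (auto dest!: hpt_eqD)
    show "proj_collinear {?e1, ?e2, hpt 1 u 0 0}"
      using e_ne by (simp add: proj_collinear_hpt_iff)
  qed
  then obtain f where f: "\<And>u. u \<in> U \<Longrightarrow> f u \<noteq> 0"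
      "\<And>u. u \<in> U \<Longrightarrow> \<phi> (hpt 1 u 0 0) = vec.span {a + f u *s b}"
    by metis
  have "\<exists>t. t \<noteq> 0 \<and> \<phi> (hpt 0 1 u 0) = vec.span {b + t *s c}" if u: "u \<in> U" for u
  proof (rule side[OF span(2,3) abc(2,3) e(2,3) edge(2)[OF u] e_ne(2)])
    show "hpt 0 1 u 0 \<noteq> ?e2" "hpt 0 1 u 0 \<noteq> ?e3"
      using U[OF u] by (auto dest!: hpt_eqD)
    show "proj_collinear {?e2, ?e3, hpt 0 1 u 0}"
      using e_ne by (simp add: proj_collinear_hpt_iff)
  qed
  then obtain g where g: "\<And>u. u \<in> U \<Longrightarrow> g u \<noteq> 0"
      "\<And>u. u \<in> U \<Longrightarrow> \<phi> (hpt 0 1 u 0) = vec.span {b + g u *s c}"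
    by metis
  have "\<exists>t. t \<noteq> 0 \<and> \<phi> (hpt 1 0 u 0) = vec.span {a + t *s c}" if u: "u \<in> U" for u
  proof (rule side[OF span(1,3) abc(1,3) e(1,3) edge(3)[OF u] e_ne(3)])
    show "hpt 1 0 u 0 \<noteq> ?e1" "hpt 1 0 u 0 \<noteq> ?e3"
      using U[OF u] by (auto dest!: hpt_eqD)
    show "proj_collinear {?e1, ?e3, hpt 1 0 u 0}"
      using e_ne by (simp add: proj_collinear_hpt_iff)
  qed
  then obtain h where h: "\<And>u. u \<in> U \<Longrightarrow> \<phi> (hpt 1 0 u 0) = vec.span {a + h u *s c}"
    by metis
  have "\<not> proj_collinear {?e1, ?e2, ?e3}"
    using e_ne by (simp add: proj_collinear_hpt_iff)
  \<comment> \<open>Here non-collinearity is carried over to the images: the real triangle does not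
    degenerate.\<close>
  then have nc: "\<not> proj_collinear {vec.span {a}, vec.span {b}, vec.span {c}}"
    unfolding span[symmetric] by (simp add: col e)
  have ab: "vec.span {a} \<noteq> vec.span {b}"
    unfolding span[symmetric] using inj_onD[OF inj] e e_ne by blast
  have fgh: "h (- (u * v)) = - f u * g v" if uv: "u \<in> U" "v \<in> U" for u v
  proof (rule collinear_on_triangle_sides[OF abc(1,2) ab nc])
    have "hpt 1 u 0 0 \<noteq> hpt 0 1 v 0"
      by (auto dest!: hpt_eqD)
    \<comment> \<open>The third vector is the first minus \<open>u\<close> times the second, whence
      the witness \<open>- u\<close>.\<close>
    then have "proj_collinear {hpt 1 u 0 0, hpt 0 1 v 0, hpt 1 0 (- (u * v)) 0}"
      by (simp add: proj_collinear_hpt_iff exI[of _ "- u"])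
    then show "proj_collinear {vec.span {a + f u *s b}, vec.span {b + g v *s c},
        vec.span {a + h (- (u * v)) *s c}}"
      using col[OF edge(1)[OF uv(1)] edge(2)[OF uv(2)] edge(3)[OF U_mult[OF uv]]]
      unfolding f(2)[OF uv(1)] g(2)[OF uv(2)] h[OF U_mult[OF uv]] by blast
    show "g v \<noteq> 0"
      using g uv by blast
  qed
  have "f (-1) = f 1"
    by (rule no_real_character_of_order_4[of U f g h]) (fact U_def f(1) g(1) fgh)+
  \<comment> \<open>Equal parameters on the side through \<open>a\<close> and \<open>b\<close> make
    two distinct Klein points share an image.\<close>
  then have "\<phi> (hpt 1 (-1) 0 0) = \<phi> (hpt 1 1 0 0)"
    using f(2) by (simp add: U_def)
  then have "hpt 1 (-1) 0 0 = (hpt 1 1 0 0 :: (complex ^ 4) set)"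
    by (rule inj_onD[OF inj]) (simp_all add: edge U_def)
  then show False
    by (auto dest!: hpt_eqD)
qed

end
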